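(* Under the hypotheses and notation of the statement that $\psi$ is a faithful embedding (irreducible principally polarized tropical abelian surface $(X,Q)$, representatives $b_0,\dots,b_3$ of $M/2\lambda(M')$, $\psi:Y=X/\langle-1\rangle\to\mathbb{TP}^3$, $[x]\mapsto(\vartheta_{b_0}(x):\dots:\vartheta_{b_3}(x))$), set $\tau_0=(\vartheta_{b_0}(0):\vartheta_{b_1}(0):\vartheta_{b_2}(0):\vartheta_{b_3}(0))$. Let the Klein group $V_4=\{\mathrm{id},(0\,1)(2\,3),(0\,2)(1\,3),(0\,3)(1\,2)\}$ act on $\mathbb{TP}^3$ by permuting coordinates and let $\iota(x_0:\dots:x_3)=(-x_0:\dots:-x_3)$. Then $\psi(Y)$, viewed in the principal torus $\cong\mathbb{R}^3$, is the boundary surface of a parallelepiped whose eight vertices are the points $g\cdot\tau_0$, $g\in V_4\times\langle\iota\rangle$, namely $\tau_i=(0\,i)(j\,k)\cdot\tau_0$ and $\widetilde\tau_i=\iota(\tau_i)$ for $i=0,1,2,3$ (with $\{i,j,k\}=\{1,2,3\}$ for $i\neq 0$).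
   Context: $M$ free of rank 2, $N=\mathrm{Hom}(M,\mathbb{Z})\subseteq N_\mathbb{R}=\mathrm{Hom}(M,\mathbb{R})$, $M'\subseteq N_\mathbb{R}$ a full lattice, $X=N_\mathbb{R}/M'$. A principal polarization is a positive-definite symmetric bilinear form $Q$ on $N_\mathbb{R}$ with $Q(M'\times N)\subseteq\mathbb{Z}$ such that $\lambda:M'\to M$, $\lambda(u')=Q(u',\cdot)|_N$, is an isomorphism. $(X,Q)$ is irreducible if it is not isomorphic (via a $\mathbb{Z}$-isomorphism of integral structures carrying lattice to lattice and form to form) to a product $(E_1\times E_2,Q_1\oplus Q_2)$ of polarized one-dimensional tropical abelian varieties. $\vartheta_b(x)=\min_{u'\in M'}\big(2Q(x,u'+(2\lambda)_\mathbb{R}^{-1}(b))+Q(u'+(2\lambda)_\mathbb{R}^{-1}(b),u'+(2\lambda)_\mathbb{R}^{-1}(b))\big)$. The principal torus of $\mathbb{TP}^3$ is $\mathbb{R}^4/\mathbb{R}(1,1,1,1)\cong\mathbb{R}^3$. *)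

theory Defs
  imports "HOL-Analysis.Analysis" "HOL-Combinatorics.Transposition"
begin

text \<open>Conventions. M and N are identified with Z^2 (dual bases), so
  N_R = real^2, N = integer points of real^2, M = integer points of real^2
  with pairing m(n) = m \<bullet> n.  A symmetric bilinear form Q on N_R is a
  function of two arguments.\<close>

definition intpts :: "(real^2) set" where
  "intpts = {x. \<forall>i. x $ i \<in> \<int>}"

definition full_lattice :: "(real^2) set \<Rightarrow> bool" where
  "full_lattice L \<longleftrightarrow> (\<exists>u1 u2. u1 \<noteq> u2 \<and> independent {u1, u2} \<and>
      L = {of_int a *\<^sub>R u1 + of_int c *\<^sub>R u2 | a c. True})"

text \<open>lambda(u') = Q(u',.) restricted to N, written in the dual basis of M;
  its R-linear extension is given by the same formula on all of N_R.\<close>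
definition lam :: "(real^2 \<Rightarrow> real^2 \<Rightarrow> real) \<Rightarrow> real^2 \<Rightarrow> real^2" where
  "lam Q u = (\<chi> i. Q u (axis i 1))"

definition principal_polarization ::
  "(real^2 \<Rightarrow> real^2 \<Rightarrow> real) \<Rightarrow> (real^2) set \<Rightarrow> bool" where
  "principal_polarization Q L \<longleftrightarrow>
     full_lattice L \<and> bilinear Q \<and> (\<forall>x y. Q x y = Q y x) \<and>
     (\<forall>x. x \<noteq> 0 \<longrightarrow> Q x x > 0) \<and>
     (\<forall>u\<in>L. \<forall>n\<in>intpts. Q u n \<in> \<int>) \<and>
     bij_betw (lam Q) L intpts"

text \<open>Reducible: Z-isomorphic (linear iso of N_R carrying N onto N = Z^2,
  the lattice onto a product lattice (c1 Z) x (c2 Z), and the form onto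
  a sum of positive one-dimensional forms) to a product of polarized
  one-dimensional tropical abelian varieties.\<close>
definition reducible_pav :: "(real^2 \<Rightarrow> real^2 \<Rightarrow> real) \<Rightarrow> (real^2) set \<Rightarrow> bool" where
  "reducible_pav Q L \<longleftrightarrow>
     (\<exists>(\<phi>::real^2 \<Rightarrow> real^2) c1 c2 q1 q2.
        linear \<phi> \<and> bij \<phi> \<and> \<phi> ` intpts = intpts \<and>
        c1 \<noteq> 0 \<and> c2 \<noteq> 0 \<and> q1 > 0 \<and> q2 > 0 \<and>
        \<phi> ` L = {vector [of_int a * c1, of_int c * c2] | a c. True} \<and>
        (\<forall>x y. Q x y = q1 * (\<phi> x $ 1) * (\<phi> y $ 1) + q2 * (\<phi> x $ 2) * (\<phi> y $ 2)))"

definition irreducible_pav :: "(real^2 \<Rightarrow> real^2 \<Rightarrow> real) \<Rightarrow> (real^2) set \<Rightarrow> bool" where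
  "irreducible_pav Q L \<longleftrightarrow> \<not> reducible_pav Q L"

definition theta :: "(real^2 \<Rightarrow> real^2 \<Rightarrow> real) \<Rightarrow> (real^2) set \<Rightarrow> real^2 \<Rightarrow> real^2 \<Rightarrow> real" where
  "theta Q L b x =
     (let c = inv (\<lambda>v. 2 *\<^sub>R lam Q v) b
      in (INF u\<in>L. 2 * Q x (u + c) + Q (u + c) (u + c)))"

definition theta_reps :: "(real^2 \<Rightarrow> real^2 \<Rightarrow> real) \<Rightarrow> (real^2) set \<Rightarrow> (nat \<Rightarrow> real^2) \<Rightarrow> bool" where
  "theta_reps Q L b \<longleftrightarrow>
     (\<forall>i<4. b i \<in> intpts) \<and>
     (\<forall>i<4. \<forall>j<4. i \<noteq> j \<longrightarrow> b i - b j \<notin> (\<lambda>u. 2 *\<^sub>R lam Q u) ` L) \<and>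
     (\<forall>m\<in>intpts. \<exists>i<4. m - b i \<in> (\<lambda>u. 2 *\<^sub>R lam Q u) ` L)"

text \<open>Points of the principal torus R^4 / R(1,1,1,1) of TP^3, identified
  with real^3 via (x_0:...:x_3) \<mapsto> (x_1-x_0, x_2-x_0, x_3-x_0).
  Homogeneous coordinates are functions nat \<Rightarrow> real, indices 0..3.\<close>
definition torus_pt :: "(nat \<Rightarrow> real) \<Rightarrow> real^3" where
  "torus_pt x = vector [x 1 - x 0, x 2 - x 0, x 3 - x 0]"

definition klein4 :: "(nat \<Rightarrow> nat) set" where
  "klein4 = {id, Transposition.transpose (0::nat) 1 \<circ> Transposition.transpose (2::nat) 3, Transposition.transpose (0::nat) 2 \<circ> Transposition.transpose (1::nat) 3,
             Transposition.transpose (0::nat) 3 \<circ> Transposition.transpose (1::nat) 2}"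

definition perm_act :: "(nat \<Rightarrow> nat) \<Rightarrow> (nat \<Rightarrow> real) \<Rightarrow> (nat \<Rightarrow> real)" where
  "perm_act \<sigma> x = (\<lambda>i. x (inv \<sigma> i))"

definition iota :: "(nat \<Rightarrow> real) \<Rightarrow> (nat \<Rightarrow> real)" where
  "iota x = (\<lambda>i. - x i)"

definition klein_iota :: "((nat \<Rightarrow> real) \<Rightarrow> (nat \<Rightarrow> real)) set" where
  "klein_iota = perm_act ` klein4 \<union> (\<lambda>\<sigma>. iota \<circ> perm_act \<sigma>) ` klein4"

definition parallelepiped :: "real^3 \<Rightarrow> real^3 \<Rightarrow> real^3 \<Rightarrow> real^3 \<Rightarrow> (real^3) set" where
  "parallelepiped p v1 v2 v3 =
     {p + s *\<^sub>R v1 + t *\<^sub>R v2 + r *\<^sub>R v3 | s t r. s \<in> {0..1} \<and> t \<in> {0..1} \<and> r \<in> {0..1}}"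

definition parallelepiped_vertices :: "real^3 \<Rightarrow> real^3 \<Rightarrow> real^3 \<Rightarrow> real^3 \<Rightarrow> (real^3) set" where
  "parallelepiped_vertices p v1 v2 v3 =
     {p + s *\<^sub>R v1 + t *\<^sub>R v2 + r *\<^sub>R v3 | s t r. s \<in> {0,1} \<and> t \<in> {0,1} \<and> r \<in> {0,1}}"

end

theory Submission
  imports Defs
begin

text \<open>Let \<open>d z = min\<^bsub>u \<in> L\<^esub> Q(z + u, z + u)\<close>. Up to the summand \<open>Q(x, x)\<close>, which disappears in the
  torus, the four theta functions are \<open>d (x + c)\<close>, where \<open>c\<close> runs over representatives of
  \<open>(1/2) L / L\<close>. The lattice has a Selling superbase \<open>w\<^sub>1 + w\<^sub>2 + w\<^sub>3 = 0\<close> with all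
  \<open>Q(w\<^sub>i, w\<^sub>j) \<le> 0\<close>; an orthogonal pair would split the polarized surface, so irreducibility makes
  these inequalities strict. Pairing homogeneous coordinates with \<open>(1,1,-1,-1)\<close>, \<open>(1,-1,1,-1)\<close> and
  \<open>(1,-1,-1,1)\<close> turns the action of \<open>V\<^sub>4\<close>, and hence translation by half lattice vectors, into sign
  changes of two coordinates. In these coordinates the parallelogram
  \<open>0 \<le> Q(x, w\<^sub>j) \<le> - Q(w\<^sub>i, w\<^sub>j)/2\<close> for \<open>j \<noteq> i\<close> is mapped affinely onto a face of the box with
  half-sides \<open>- Q(w\<^sub>j, w\<^sub>k)/2\<close>, and the three parallelograms cover the plane up to \<open>(1/2) L\<close>.\<close>

section \<open>Boxes and parallelepipeds\<close>

lemma frontier_symmetric_box: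
  fixes c :: "real^'n"
  shows "frontier (cbox (- c) c) = {y. (\<forall>i. \<bar>y $ i\<bar> \<le> c $ i) \<and> (\<exists>i. \<bar>y $ i\<bar> = c $ i)}"
proof -
  have "cbox (- c) c = {y. \<forall>i. \<bar>y $ i\<bar> \<le> c $ i}" "box (- c) c = {y. \<forall>i. \<bar>y $ i\<bar> < c $ i}"
    by (auto simp: mem_box_cart abs_le_iff abs_less_iff minus_le_iff minus_less_iff)
  then show ?thesis
    unfolding frontier_cbox by (fastforce simp: less_le)
qed

lemma frontier_injective_linear_image:
  fixes f :: "'a::euclidean_space \<Rightarrow> 'a"
  assumes "linear f" "inj f"
  shows "frontier (f ` S) = f ` frontier S"
  unfolding frontier_def closure_injective_linear_image[OF assms, symmetric]
    interior_injective_linear_image[OF assms]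
  by (simp add: image_set_diff[OF assms(2)])

lemma independent_scaled_axes:
  fixes d :: "real^'n"
  assumes "\<And>i. d $ i \<noteq> 0"
  shows "inj (\<lambda>i. axis i (d $ i))" "independent (range (\<lambda>i. axis i (d $ i)))"
proof -
  show "inj (\<lambda>i. axis i (d $ i))"
    using assms by (simp add: inj_def axis_eq_axis)
  have "pairwise orthogonal (range (\<lambda>i. axis i (d $ i)))"
    by (auto simp: pairwise_def orthogonal_def inner_axis_axis)
  then show "independent (range (\<lambda>i. axis i (d $ i)))"
    using assms by (intro pairwise_orthogonal_independent) (auto simp: axis_eq_0_iff)
qed

lemma linear_image_box_edges:
  fixes T :: "real^3 \<Rightarrow> real^3" and a b :: "real^3"
  assumes T: "linear T"
  defines "v \<equiv> \<lambda>i. T (axis i (b $ i - a $ i))"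
  shows "T ` {x. \<forall>i. x $ i \<in> (\<lambda>t. a $ i + t * (b $ i - a $ i)) ` S} =
    {T a + s *\<^sub>R v 1 + t *\<^sub>R v 2 + r *\<^sub>R v 3 | s t r. s \<in> S \<and> t \<in> S \<and> r \<in> S}"
    (is "T ` ?X = _")
proof -
  define point where "point s t r = (\<chi> i. a $ i + vector [s, t, r] $ i * (b $ i - a $ i))" for s t r
  have T_point: "T a + s *\<^sub>R v 1 + t *\<^sub>R v 2 + r *\<^sub>R v 3 = T (point s t r)" for s t r
  proof -
    have "point s t r =
      a + s *\<^sub>R axis 1 (b $ 1 - a $ 1) + t *\<^sub>R axis 2 (b $ 2 - a $ 2) + r *\<^sub>R axis 3 (b $ 3 - a $ 3)"
      by (simp add: point_def vec_eq_iff forall_3 axis_def)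
    then show ?thesis
      by (simp add: v_def linear_add[OF T] linear_cmul[OF T])
  qed
  have "?X = {point s t r | s t r. s \<in> S \<and> t \<in> S \<and> r \<in> S}"
  proof (intro equalityI subsetI)
    fix x assume "x \<in> ?X"
    then obtain s t r where "s \<in> S" "t \<in> S" "r \<in> S" "x = point s t r"
      by (auto simp: point_def vec_eq_iff forall_3)
    then show "x \<in> {point s t r | s t r. s \<in> S \<and> t \<in> S \<and> r \<in> S}"
      by blast
  qed (auto simp: point_def forall_3)
  then show ?thesis
    unfolding T_point by auto
qed

lemma atLeastAtMost_eq_affine_image:
  fixes \<alpha> \<beta> :: real
  assumes "\<alpha> < \<beta>"
  shows "{\<alpha>..\<beta>} = (\<lambda>t. \<alpha> + t * (\<beta> - \<alpha>)) ` {0..1}"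
  using assms image_affinity_atLeastAtMost[of "\<beta> - \<alpha>" \<alpha> 0 1] by (simp add: ac_simps)

lemma linear_image_box_parallelepiped:
  fixes T :: "real^3 \<Rightarrow> real^3"
  assumes T: "linear T" "inj T" and less: "\<And>i. a $ i < b $ i"
  obtains p v1 v2 v3 where "v1 \<noteq> v2" "v1 \<noteq> v3" "v2 \<noteq> v3" "independent {v1, v2, v3}"
    "T ` cbox a b = parallelepiped p v1 v2 v3"
    "T ` {x. \<forall>i. x $ i \<in> {a $ i, b $ i}} = parallelepiped_vertices p v1 v2 v3"
proof -
  define e where "e i = axis i (b $ i - a $ i)" for i
  have e: "inj e" "independent (range e)"
    using independent_scaled_axes[of "b - a"] less by (simp_all add: e_def[abs_def] less_imp_neq[symmetric])
  define v where "v i = T (e i)" for i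
  have "inj v"
    using inj_compose[OF T(2) e(1)] by (simp add: v_def[abs_def] o_def)
  then have "v 1 \<noteq> v 2" "v 1 \<noteq> v 3" "v 2 \<noteq> v 3"
    by (simp_all add: inj_eq)
  moreover have "independent {v 1, v 2, v 3}"
  proof -
    have "independent (T ` range e)"
      using linear_independent_injective_image[OF T(1) e(2)] inj_on_subset[OF T(2)] by blast
    also have "T ` range e = {v 1, v 2, v 3}"
      unfolding UNIV_3 by (simp add: v_def)
    finally show ?thesis .
  qed
  moreover have "T ` cbox a b = parallelepiped (T a) (v 1) (v 2) (v 3)"
  proof -
    have "cbox a b = {x. \<forall>i. x $ i \<in> (\<lambda>t. a $ i + t * (b $ i - a $ i)) ` {0..1}}"
      by (simp add: atLeastAtMost_eq_affine_image[OF less, symmetric] set_eq_iff mem_box_cart)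
    then show ?thesis
      unfolding parallelepiped_def v_def e_def by (simp only: linear_image_box_edges[OF T(1)])
  qed
  moreover have "T ` {x. \<forall>i. x $ i \<in> {a $ i, b $ i}} = parallelepiped_vertices (T a) (v 1) (v 2) (v 3)"
  proof -
    have "{a $ i, b $ i} = (\<lambda>t. a $ i + t * (b $ i - a $ i)) ` {0, 1}" for i
      by simp
    then show ?thesis
      unfolding parallelepiped_vertices_def v_def e_def by (simp only: linear_image_box_edges[OF T(1)])
  qed
  ultimately show thesis
    by (rule that)
qed

section \<open>Hadamard coordinates\<close>

definition hadamard :: "(nat \<Rightarrow> real) \<Rightarrow> real^3" where
  "hadamard x = vector [x 0 + x 1 - x 2 - x 3, x 0 + x 2 - x 1 - x 3, x 0 + x 3 - x 1 - x 2]"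

definition inverse_hadamard :: "real^3 \<Rightarrow> real^3" where
  "inverse_hadamard y = (\<chi> i. (y $ i - (\<Sum>j\<in>UNIV. y $ j)) / 2)"

lemma torus_pt_eq_inverse_hadamard: "torus_pt x = inverse_hadamard (hadamard x)"
  by (simp add: torus_pt_def inverse_hadamard_def hadamard_def vec_eq_iff forall_3 sum_3)

lemma linear_inverse_hadamard: "linear inverse_hadamard"
  by (rule linearI)
    (simp_all add: inverse_hadamard_def vec_eq_iff sum_3 field_simps)

lemma inj_inverse_hadamard: "inj inverse_hadamard"
  unfolding linear_injective_0[OF linear_inverse_hadamard]
  by (simp add: inverse_hadamard_def vec_eq_iff forall_3 sum_3)

lemma hadamard_iota: "hadamard (iota x) = - hadamard x"
  by (simp add: hadamard_def iota_def vec_eq_iff forall_3)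

lemma hadamard_klein4:
  "hadamard (perm_act (Transposition.transpose 0 1 \<circ> Transposition.transpose 2 3) x) =
    vector [hadamard x $ 1, - hadamard x $ 2, - hadamard x $ 3]"
  "hadamard (perm_act (Transposition.transpose 0 2 \<circ> Transposition.transpose 1 3) x) =
    vector [- hadamard x $ 1, hadamard x $ 2, - hadamard x $ 3]"
  "hadamard (perm_act (Transposition.transpose 0 3 \<circ> Transposition.transpose 1 2) x) =
    vector [- hadamard x $ 1, - hadamard x $ 2, hadamard x $ 3]"
  by (simp_all add: hadamard_def perm_act_def o_inv_distrib transpose_def vec_eq_iff forall_3)

lemma hadamard_klein_iota_orbit:
  "(\<lambda>g. hadamard (g x)) ` klein_iota = {y. \<forall>i. \<bar>y $ i\<bar> = \<bar>hadamard x $ i\<bar>}"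
proof -
  have "perm_act id x = x"
    by (simp add: perm_act_def)
  then have "(\<lambda>g. hadamard (g x)) ` klein_iota =
    {hadamard x, vector [hadamard x $ 1, - hadamard x $ 2, - hadamard x $ 3],
      vector [- hadamard x $ 1, hadamard x $ 2, - hadamard x $ 3],
      vector [- hadamard x $ 1, - hadamard x $ 2, hadamard x $ 3]} \<union>
    {- hadamard x, - vector [hadamard x $ 1, - hadamard x $ 2, - hadamard x $ 3],
      - vector [- hadamard x $ 1, hadamard x $ 2, - hadamard x $ 3],
      - vector [- hadamard x $ 1, - hadamard x $ 2, hadamard x $ 3]}"
    unfolding klein_iota_def klein4_def image_Un image_insert image_empty comp_apply[of iota]
    by (simp only: hadamard_klein4 hadamard_iota)
  also have "\<dots> = {y. \<forall>i. \<bar>y $ i\<bar> = \<bar>hadamard x $ i\<bar>}"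
    by (auto simp: vec_eq_iff forall_3 abs_eq_iff)
  finally show ?thesis .
qed

lemma torus_pt_klein_iota_orbit:
  "{torus_pt (g x) | g. g \<in> klein_iota} =
    inverse_hadamard ` {y. \<forall>i. \<bar>y $ i\<bar> = \<bar>hadamard x $ i\<bar>}"
  unfolding torus_pt_eq_inverse_hadamard hadamard_klein_iota_orbit[symmetric] by blast

section \<open>Positive definite forms and plane lattices\<close>

locale positive_definite_form =
  fixes Q :: "'a::real_vector \<Rightarrow> 'a \<Rightarrow> real"
  assumes bilinear: "bilinear Q"
    and commute: "Q x y = Q y x"
    and positive: "x \<noteq> 0 \<Longrightarrow> 0 < Q x x"
begin

lemmas form_simps =
  bilinear_ladd[OF bilinear] bilinear_radd[OF bilinear]
  bilinear_lsub[OF bilinear] bilinear_rsub[OF bilinear]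
  bilinear_lneg[OF bilinear] bilinear_rneg[OF bilinear]
  bilinear_lmul[OF bilinear] bilinear_rmul[OF bilinear]
  bilinear_lzero[OF bilinear] bilinear_rzero[OF bilinear]

lemma nonneg: "0 \<le> Q x x"
  using positive[of x] by (cases "x = 0") (auto simp: form_simps)

lemma form_add_self: "Q (x + y) (x + y) = Q x x + 2 * Q x y + Q y y"
  by (simp add: form_simps commute[of y x])

lemma gram_determinant_positive:
  assumes "u \<noteq> v" "independent {u, v}"
  shows "0 < Q u u * Q v v - (Q u v)\<^sup>2"
proof -
  have "u \<notin> span {v}" "v \<noteq> 0"
    using assms by (auto simp: independent_insert)
  define z where "z = u - (Q u v / Q v v) *\<^sub>R v"
  have "z \<noteq> 0"
    using \<open>u \<notin> span {v}\<close> by (auto simp: z_def span_singleton)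
  have "0 < Q v v"
    by (rule positive) fact
  have "Q u u * Q v v - (Q u v)\<^sup>2 = Q v v * Q z z"
    using \<open>0 < Q v v\<close> by (simp add: z_def form_simps commute[of v u] field_simps power2_eq_square)
  then show ?thesis
    using \<open>0 < Q v v\<close> positive[OF \<open>z \<noteq> 0\<close>] by simp
qed

lemma coordinate_bound:
  "a\<^sup>2 * (Q u u * Q v v - (Q u v)\<^sup>2) \<le> Q (a *\<^sub>R u + c *\<^sub>R v) (a *\<^sub>R u + c *\<^sub>R v) * Q v v"
proof -
  let ?x = "a *\<^sub>R u + c *\<^sub>R v"
  have "a\<^sup>2 * (Q u u * Q v v - (Q u v)\<^sup>2) + (Q ?x v)\<^sup>2 = Q ?x ?x * Q v v"
    by (simp add: form_simps commute[of v u] power2_eq_square algebra_simps)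
  then show ?thesis
    by (metis le_add_same_cancel1 zero_le_power2)
qed

end

locale lattice_plane = positive_definite_form Q
  for Q :: "'a::real_vector \<Rightarrow> 'a \<Rightarrow> real" +
  fixes L :: "'a set"
  assumes basis_exists: "\<exists>u v. u \<noteq> v \<and> independent {u, v} \<and> span {u, v} = UNIV \<and>
      L = {of_int a *\<^sub>R u + of_int c *\<^sub>R v | a c. True}"
begin

definition lattice_basis :: "'a \<Rightarrow> 'a \<Rightarrow> bool" where
  "lattice_basis u v \<longleftrightarrow> L = {of_int a *\<^sub>R u + of_int c *\<^sub>R v | a c. True}"

lemma lattice_basis_exists: "\<exists>u v. lattice_basis u v"
  using basis_exists unfolding lattice_basis_def by blast

lemma lattice_basisE:
  assumes "lattice_basis u v" "x \<in> L"
  obtains a c where "x = of_int a *\<^sub>R u + of_int c *\<^sub>R v"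
  using assms unfolding lattice_basis_def by blast

lemma lattice_basis_combination_mem:
  "lattice_basis u v \<Longrightarrow> of_int a *\<^sub>R u + of_int c *\<^sub>R v \<in> L"
  unfolding lattice_basis_def by blast

lemma lattice_basis_mem:
  assumes "lattice_basis u v"
  shows "u \<in> L" "v \<in> L"
  using lattice_basis_combination_mem[OF assms, of 1 0]
    lattice_basis_combination_mem[OF assms, of 0 1] by auto

lemma lattice_zero: "0 \<in> L"
  using lattice_basis_exists lattice_basis_combination_mem[of _ _ 0 0] by auto

lemma lattice_diff:
  assumes "x \<in> L" "y \<in> L"
  shows "x - y \<in> L"
proof -
  obtain u v where uv: "lattice_basis u v"
    using lattice_basis_exists by blast
  obtain a c where x: "x = of_int a *\<^sub>R u + of_int c *\<^sub>R v"
    using uv assms(1) by (rule lattice_basisE)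
  obtain a' c' where y: "y = of_int a' *\<^sub>R u + of_int c' *\<^sub>R v"
    using uv assms(2) by (rule lattice_basisE)
  have "x - y = of_int (a - a') *\<^sub>R u + of_int (c - c') *\<^sub>R v"
    by (simp add: x y algebra_simps)
  then show ?thesis
    using lattice_basis_combination_mem[OF uv] by metis
qed

lemma lattice_uminus: "x \<in> L \<Longrightarrow> - x \<in> L"
  using lattice_diff[OF lattice_zero] by simp

lemma lattice_add: "x \<in> L \<Longrightarrow> y \<in> L \<Longrightarrow> x + y \<in> L"
  using lattice_diff[of x "- y"] lattice_uminus by simp

lemma lattice_basis_unimodular:
  assumes uv: "lattice_basis u v" and det: "\<bar>p * s - q * r\<bar> = 1"
  shows "lattice_basis (of_int p *\<^sub>R u + of_int q *\<^sub>R v) (of_int r *\<^sub>R u + of_int s *\<^sub>R v)"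
    (is "lattice_basis ?u ?v")
proof -
  define d where "d = p * s - q * r"
  have "d * d = 1"
    using det unfolding d_def by (metis abs_mult_self_eq mult_1)
  have "\<exists>a' c'. x = of_int a' *\<^sub>R ?u + of_int c' *\<^sub>R ?v" if x: "x \<in> L" for x
  proof -
    obtain a c where x: "x = of_int a *\<^sub>R u + of_int c *\<^sub>R v"
      using uv x by (rule lattice_basisE)
    define a' c' where "a' = d * (a * s - c * r)" and "c' = d * (c * p - a * q)"
    have "a' * p + c' * r = d * d * a" "a' * q + c' * s = d * d * c"
      unfolding a'_def c'_def by (simp_all add: d_def algebra_simps)
    then have "a = a' * p + c' * r" "c = a' * q + c' * s"
      using \<open>d * d = 1\<close> by simp_all
    then show ?thesis
      unfolding x by (intro exI[of _ a'] exI[of _ c']) (simp add: algebra_simps)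
  qed
  moreover have "of_int a *\<^sub>R ?u + of_int c *\<^sub>R ?v \<in> L" for a c
    using lattice_basis_combination_mem[OF uv, of "a * p + c * r" "a * q + c * s"]
    by (simp add: algebra_simps)
  ultimately show ?thesis
    unfolding lattice_basis_def by blast
qed

lemma lattice_basis_swap: "lattice_basis u v \<Longrightarrow> lattice_basis v u"
  using lattice_basis_unimodular[of u v, where p = 0 and q = 1 and r = 1 and s = 0] by simp

lemma lattice_basis_uminus: "lattice_basis u v \<Longrightarrow> lattice_basis u (- v)"
  using lattice_basis_unimodular[of u v, where p = 1 and q = 0 and r = 0 and s = "- 1"] by simp

lemma lattice_basis_uminus_add: "lattice_basis u v \<Longrightarrow> lattice_basis u (- u - v)"
  using lattice_basis_unimodular[of u v, where p = 1 and q = 0 and r = "- 1" and s = "- 1"] by simp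

lemma lattice_basis_span:
  assumes "lattice_basis u v"
  shows "span {u, v} = UNIV"
proof -
  obtain u0 v0 where "span {u0, v0} = UNIV" "lattice_basis u0 v0"
    using basis_exists unfolding lattice_basis_def by blast
  moreover have "L \<subseteq> span {u, v}"
    using assms unfolding lattice_basis_def
    by (auto intro!: span_add span_scale intro: span_base)
  ultimately show ?thesis
    using lattice_basis_mem[of u0 v0] span_mono[of "{u0, v0}" "span {u, v}"]
    by (auto simp: span_span)
qed

lemma lattice_basis_independent:
  assumes "lattice_basis u v"
  shows "u \<noteq> v" "independent {u, v}"
proof -
  have small_spanning_set: False if "span T = UNIV" "finite T" "card T \<le> 1" for T :: "'a set"
  proof -
    obtain u0 v0 :: 'a where "u0 \<noteq> v0" "independent {u0, v0}"
      using basis_exists by blast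
    then show False
      using independent_span_bound[of T "{u0, v0}"] that by simp
  qed
  have not_collinear: "u \<notin> span {v}"
  proof
    assume "u \<in> span {v}"
    then have "span {v} = UNIV"
      using lattice_basis_span[OF assms] by (simp only: span_redundant)
    then show False
      by (rule small_spanning_set) simp_all
  qed
  then show "u \<noteq> v"
    using span_base[of v "{v}"] by blast
  moreover have "v \<noteq> 0"
  proof
    assume "v = 0"
    then have "span {u} = UNIV"
      using lattice_basis_span[OF assms] span_insert_0[of "{u}"] by (simp only: insert_commute)
    then show False
      by (rule small_spanning_set) simp_all
  qed
  ultimately show "independent {u, v}"
    using not_collinear by (simp add: independent_insert)
qed

lemma lattice_basis_coordinates:
  assumes "lattice_basis u v"
  obtains a c where "x = a *\<^sub>R u + c *\<^sub>R v"
proof -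
  have "x \<in> span {u, v}"
    using lattice_basis_span[OF assms] by simp
  then obtain a c where "x - a *\<^sub>R u = c *\<^sub>R v"
    by (auto simp: span_breakdown_eq span_singleton)
  then show thesis
    using that by (simp add: diff_eq_eq add.commute)
qed

lemma lattice_basis_gram_positive:
  "lattice_basis u v \<Longrightarrow> 0 < Q u u * Q v v - (Q u v)\<^sup>2"
  using gram_determinant_positive lattice_basis_independent by blast

lemma prescribed_pairings_exist:
  assumes "lattice_basis u v"
  obtains x where "Q x u = s" "Q x v = t"
proof -
  define D where "D = Q u u * Q v v - (Q u v)\<^sup>2"
  define x where "x = ((s * Q v v - t * Q u v) / D) *\<^sub>R u + ((t * Q u u - s * Q u v) / D) *\<^sub>R v"
  have "D \<noteq> 0"
    using lattice_basis_gram_positive[OF assms] by (simp add: D_def)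
  have "Q x u = s * D / D" "Q x v = t * D / D"
    by (simp_all add: x_def D_def form_simps commute[of v u] power2_eq_square algebra_simps
        flip: add_divide_distrib diff_divide_distrib)
  then show thesis
    using that \<open>D \<noteq> 0\<close> by simp
qed

lemma orthogonal_basis_expansion:
  assumes uv: "lattice_basis u v" and orthogonal: "Q u v = 0"
  shows "x = (Q u x / Q u u) *\<^sub>R u + (Q v x / Q v v) *\<^sub>R v"
proof -
  obtain a c where "x = a *\<^sub>R u + c *\<^sub>R v"
    using uv by (rule lattice_basis_coordinates)
  moreover have "Q u u \<noteq> 0" "Q v v \<noteq> 0" "Q v u = 0"
    using lattice_basis_gram_positive[OF uv] orthogonal by (auto simp: commute[of v u])
  ultimately show ?thesis
    using orthogonal by (simp add: form_simps)
qed

lemma lattice_basis_coordinates_bounded: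
  assumes uv: "lattice_basis u v"
    and x: "Q x x \<le> R" "x = a *\<^sub>R u + c *\<^sub>R v"
  defines "D \<equiv> Q u u * Q v v - (Q u v)\<^sup>2"
  shows "\<bar>a\<bar> \<le> sqrt (R * Q v v / D)" "\<bar>c\<bar> \<le> sqrt (R * Q u u / D)"
proof -
  have "0 < D"
    using lattice_basis_gram_positive[OF uv] by (simp add: D_def)
  have bound: "\<bar>t\<bar> \<le> sqrt (R * Q y y / D)" if "t\<^sup>2 * D \<le> Q x x * Q y y" for t y
  proof -
    have "t\<^sup>2 * D \<le> R * Q y y"
      using that mult_right_mono[OF x(1) nonneg] by (rule order_trans)
    then have "t\<^sup>2 \<le> R * Q y y / D"
      using \<open>0 < D\<close> by (simp add: field_simps)
    then show ?thesis
      by (intro real_le_rsqrt) simp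
  qed
  show "\<bar>a\<bar> \<le> sqrt (R * Q v v / D)"
    using coordinate_bound[of a u v c] by (intro bound) (simp add: D_def x(2))
  show "\<bar>c\<bar> \<le> sqrt (R * Q u u / D)"
    using coordinate_bound[of c v u a]
    by (intro bound) (simp add: D_def x(2) ac_simps commute[of v u])
qed

lemma finite_short_vectors: "finite {x \<in> L. Q x x \<le> R}"
proof -
  obtain u v where uv: "lattice_basis u v"
    using lattice_basis_exists by blast
  define A where "A y = {k \<in> \<int>. \<bar>k\<bar> \<le> sqrt (R * Q y y / (Q u u * Q v v - (Q u v)\<^sup>2))}" for y
  have "{x \<in> L. Q x x \<le> R} \<subseteq> (\<lambda>(a, c). a *\<^sub>R u + c *\<^sub>R v) ` (A v \<times> A u)"
  proof clarify
    fix x assume x: "x \<in> L" "Q x x \<le> R"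
    obtain a c where x_eq: "x = of_int a *\<^sub>R u + of_int c *\<^sub>R v"
      using uv x(1) by (rule lattice_basisE)
    then have "(of_int a, of_int c) \<in> A v \<times> A u"
      using lattice_basis_coordinates_bounded[OF uv x(2) x_eq] by (simp add: A_def)
    then show "x \<in> (\<lambda>(a, c). a *\<^sub>R u + c *\<^sub>R v) ` (A v \<times> A u)"
      unfolding x_eq by (rule rev_image_eqI) simp
  qed
  then show ?thesis
    by (rule finite_subset) (simp add: A_def finite_abs_int_segment)
qed

text \<open>A minimal basis is obtuse, since replacing \<open>v\<close> by \<open>- v\<close> lowers the sum when \<open>Q u v > 0\<close>; the
  third vector \<open>- u - v\<close> enters symmetrically.\<close>
definition selling_sum :: "'a \<Rightarrow> 'a \<Rightarrow> real" where
  "selling_sum u v = Q u u + Q v v + Q (u + v) (u + v)"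

lemma minimal_selling_sum_exists:
  obtains u v where "lattice_basis u v"
    "\<And>u' v'. lattice_basis u' v' \<Longrightarrow> selling_sum u v \<le> selling_sum u' v'"
proof -
  obtain u0 v0 where uv0: "lattice_basis u0 v0"
    using lattice_basis_exists by blast
  define R where "R = selling_sum u0 v0"
  define B where "B = {(u, v). lattice_basis u v \<and> selling_sum u v \<le> R}"
  have "B \<subseteq> {u \<in> L. Q u u \<le> R} \<times> {v \<in> L. Q v v \<le> R}"
  proof clarify
    fix u v assume "(u, v) \<in> B"
    then have "lattice_basis u v" "selling_sum u v \<le> R"
      by (auto simp: B_def)
    then show "u \<in> {u \<in> L. Q u u \<le> R} \<and> v \<in> {v \<in> L. Q v v \<le> R}"
      using lattice_basis_mem nonneg[of u] nonneg[of v] nonneg[of "u + v"]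
      by (simp add: selling_sum_def)
  qed
  then have "finite B"
    by (rule finite_subset) (intro finite_cartesian_product finite_short_vectors)
  moreover have "(u0, v0) \<in> B"
    using uv0 by (simp add: B_def R_def)
  ultimately obtain u v where
    "is_arg_min (\<lambda>(u, v). selling_sum u v) (\<lambda>p. p \<in> B) (u, v)"
    using ex_is_arg_min_if_finite[of B "\<lambda>(u, v). selling_sum u v"] by fastforce
  then have "(u, v) \<in> B" "\<And>u' v'. (u', v') \<in> B \<Longrightarrow> selling_sum u v \<le> selling_sum u' v'"
    by (force simp: is_arg_min_linorder)+
  moreover from this have "selling_sum u v \<le> selling_sum u' v'" if "lattice_basis u' v'" for u' v'
    using that by (cases "selling_sum u' v' \<le> R") (auto simp: B_def)
  ultimately show thesis
    using that by (auto simp: B_def)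
qed

definition sqdist :: "'a \<Rightarrow> real" where
  "sqdist z = (INF u\<in>L. Q (z + u) (z + u))"

lemma sqdist_eqI:
  assumes "u \<in> L" "\<And>v. v \<in> L \<Longrightarrow> Q (z + u) (z + u) \<le> Q (z + v) (z + v)"
  shows "sqdist z = Q (z + u) (z + u)"
  unfolding sqdist_def using assms by (intro cInf_eq_minimum) auto

lemma sqdist_periodic:
  assumes "u \<in> L"
  shows "sqdist (z + u) = sqdist z"
proof -
  have "(+) u ` L = L"
  proof
    show "(+) u ` L \<subseteq> L"
      using lattice_add[OF assms] by blast
    show "L \<subseteq> (+) u ` L"
      using lattice_diff[OF _ assms] by (auto intro!: image_eqI[where x = "_ - u"])
  qed
  then have "(\<lambda>v. Q (z + v) (z + v)) ` L = (\<lambda>v. Q (z + u + v) (z + u + v)) ` L"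
    by (metis (no_types, lifting) add.assoc image_cong image_image)
  then show ?thesis
    by (simp add: sqdist_def)
qed

lemma sqdist_cong: "z - z' \<in> L \<Longrightarrow> sqdist z = sqdist z'"
  using sqdist_periodic[of "z - z'" z'] by simp

end

section \<open>Obtuse superbases\<close>

lemma ex_third_index:
  fixes i j :: 3
  assumes "i \<noteq> j"
  obtains k where "distinct [i, j, k]"
proof -
  have "card {i, j} \<noteq> CARD(3)"
    using assms by simp
  then have "{i, j} \<noteq> UNIV"
    by metis
  then obtain k where "k \<notin> {i, j}"
    by blast
  then show thesis
    using assms by (intro that[of k]) auto
qed

lemma ex_other_indices:
  fixes i :: 3
  obtains j k where "distinct [i, j, k]"
proof -
  have "i \<noteq> i + 1"
    by simp
  then obtain k where "distinct [i, i + 1, k]"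
    by (rule ex_third_index)
  then show thesis
    by (rule that)
qed

lemma UNIV_distinct_3:
  fixes i j k :: 3
  assumes "distinct [i, j, k]"
  shows "UNIV = {i, j, k}"
  by (rule card_subset_eq[symmetric]) (use assms in auto)

lemma sum_distinct_3:
  fixes i j k :: 3
  assumes "distinct [i, j, k]"
  shows "sum f UNIV = f i + f j + f k"
  using assms unfolding UNIV_distinct_3[OF assms] by (simp add: add.assoc)

lemma forall_distinct_3:
  fixes i j k :: 3
  assumes "distinct [i, j, k]"
  shows "(\<forall>m. P m) \<longleftrightarrow> P i \<and> P j \<and> P k"
  using UNIV_distinct_3[OF assms] by (metis UNIV_I empty_iff insert_iff)

locale obtuse_superbase = lattice_plane Q L
  for Q :: "'a::real_vector \<Rightarrow> 'a \<Rightarrow> real" and L :: "'a set" +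
  fixes w :: "3 \<Rightarrow> 'a"
  assumes sum_zero: "sum w UNIV = 0"
    and basis: "i \<noteq> j \<Longrightarrow> lattice_basis (w i) (w j)"
    and obtuse: "i \<noteq> j \<Longrightarrow> Q (w i) (w j) < 0"

lemma (in lattice_plane) obtuse_superbase_exists:
  assumes no_orthogonal_basis: "\<And>u v. lattice_basis u v \<Longrightarrow> Q u v \<noteq> 0"
  obtains w where "obtuse_superbase Q L w"
proof -
  obtain u v where uv: "lattice_basis u v"
    and minimal: "\<And>u' v'. lattice_basis u' v' \<Longrightarrow> selling_sum u v \<le> selling_sum u' v'"
    using minimal_selling_sum_exists by blast
  have negative: "Q u' v' < 0"
    if "lattice_basis u' v'" and eq: "selling_sum u' v' = selling_sum u v" for u' v'
  proof -
    have "selling_sum u' v' \<le> selling_sum u' (- v')"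
      unfolding eq by (rule minimal[OF lattice_basis_uminus[OF that(1)]])
    then have "Q u' v' \<le> 0"
      by (simp add: selling_sum_def form_simps commute[of v' u'])
    with no_orthogonal_basis[OF that(1)] show ?thesis
      by simp
  qed
  define w :: "3 \<Rightarrow> 'a" where "w = ($) (vector [u, v, - u - v])"
  have bases: "lattice_basis u (- u - v)" "lattice_basis v (- u - v)"
    using lattice_basis_uminus_add[OF uv] lattice_basis_uminus_add[OF lattice_basis_swap[OF uv]]
    by (simp_all only: minus_diff_commute[of v u])
  have "selling_sum u (- u - v) = selling_sum u v" "selling_sum v (- u - v) = selling_sum u v"
    by (simp_all add: selling_sum_def form_simps)
  then have "Q u v < 0" "Q u (- u - v) < 0" "Q v (- u - v) < 0"
    using negative[OF uv] negative[OF bases(1)] negative[OF bases(2)] by simp_all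
  then have "lattice_basis (w i) (w j) \<and> Q (w i) (w j) < 0" if "i \<noteq> j" for i j
    using exhaust_3[of i] exhaust_3[of j] that uv bases uv[THEN lattice_basis_swap]
      bases[THEN lattice_basis_swap] commute[of v u] commute[of "- u - v" u] commute[of "- u - v" v]
    by (elim disjE) (simp_all add: w_def)
  then have "obtuse_superbase Q L w"
    by unfold_locales (auto simp: sum_3 w_def)
  then show thesis
    by (rule that)
qed

context obtuse_superbase
begin

lemma superbase_third:
  assumes "distinct [i, j, k]"
  shows "w k = - w i - w j"
  using sum_zero sum_distinct_3[OF assms, of w] by (simp add: eq_neg_iff_add_eq_0 algebra_simps)

lemma superbase_mem: "w i \<in> L"
  using lattice_basis_mem(1)[OF basis[of i "i + 1"]] by simp

lemma superbase_reindex: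
  assumes "inj \<sigma>"
  shows "obtuse_superbase Q L (w \<circ> \<sigma>)"
proof unfold_locales
  have "bij \<sigma>"
    using assms by (simp add: bij_def finite_UNIV_inj_surj)
  then show "sum (w \<circ> \<sigma>) UNIV = 0"
    using sum_zero sum.reindex_bij_betw[of \<sigma> UNIV UNIV w] by (simp add: o_def)
qed (use assms in \<open>auto intro!: basis obtuse simp: inj_eq\<close>)

definition half_sqdists :: "'a \<Rightarrow> nat \<Rightarrow> real" where
  "half_sqdists x n = sqdist (if n = 0 then x else x + (1/2) *\<^sub>R w (of_nat n))"

text \<open>Up to translation by the half lattice vector belonging to \<open>b 0\<close>, this is \<open>\<psi>\<close> in Hadamard
  coordinates.\<close>
definition kummer :: "'a \<Rightarrow> real^3" where
  "kummer x = hadamard (half_sqdists x)"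

lemma kummer_nth:
  assumes "distinct [i, j, k]"
  shows "kummer x $ i = sqdist x + sqdist (x + (1/2) *\<^sub>R w i)
    - sqdist (x + (1/2) *\<^sub>R w j) - sqdist (x + (1/2) *\<^sub>R w k)"
proof -
  have "kummer x $ i = sqdist x + 2 * sqdist (x + (1/2) *\<^sub>R w i)
      - (\<Sum>m\<in>UNIV. sqdist (x + (1/2) *\<^sub>R w m))"
    using exhaust_3[of i] by (auto simp: kummer_def hadamard_def half_sqdists_def sum_3)
  then show ?thesis
    unfolding sum_distinct_3[OF assms] by simp
qed

lemma sqdist_half_twice: "sqdist (x + (1/2) *\<^sub>R w i + (1/2) *\<^sub>R w i) = sqdist x"
  by (rule sqdist_cong) (use superbase_mem in \<open>simp flip: scaleR_add_left\<close>)

lemma sqdist_half_add: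
  assumes "distinct [i, j, k]"
  shows "sqdist (x + (1/2) *\<^sub>R w i + (1/2) *\<^sub>R w j) = sqdist (x + (1/2) *\<^sub>R w k)"
proof (rule sqdist_cong)
  have "x + (1/2) *\<^sub>R w i + (1/2) *\<^sub>R w j - (x + (1/2) *\<^sub>R w k) = - w k"
    unfolding superbase_third[OF assms] by (simp add: algebra_simps flip: scaleR_add_left)
  then show "x + (1/2) *\<^sub>R w i + (1/2) *\<^sub>R w j - (x + (1/2) *\<^sub>R w k) \<in> L"
    using lattice_uminus[OF superbase_mem] by simp
qed

lemma kummer_periodic:
  assumes "u \<in> L"
  shows "kummer (x + u) = kummer x"
proof -
  have "sqdist (x + u + z) = sqdist (x + z)" for z
    using sqdist_periodic[OF assms, of "x + z"] by (simp add: ac_simps)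
  then have "half_sqdists (x + u) = half_sqdists x"
    using sqdist_periodic[OF assms] by (simp add: half_sqdists_def fun_eq_iff)
  then show ?thesis
    by (simp add: kummer_def)
qed

lemma kummer_half_shift: "kummer (x + (1/2) *\<^sub>R w j) $ i = (if i = j then 1 else - 1) * kummer x $ i"
proof (cases "i = j")
  case True
  obtain l k where ilk: "distinct [i, l, k]"
    by (rule ex_other_indices)
  have "sqdist (x + (1/2) *\<^sub>R w i + (1/2) *\<^sub>R w l) = sqdist (x + (1/2) *\<^sub>R w k)"
    "sqdist (x + (1/2) *\<^sub>R w i + (1/2) *\<^sub>R w k) = sqdist (x + (1/2) *\<^sub>R w l)"
    by (rule sqdist_half_add; use ilk in auto)+
  then show ?thesis
    by (simp add: kummer_nth[OF ilk] sqdist_half_twice flip: True)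
next
  case False
  then obtain k where ijk: "distinct [i, j, k]"
    by (rule ex_third_index)
  have "sqdist (x + (1/2) *\<^sub>R w j + (1/2) *\<^sub>R w i) = sqdist (x + (1/2) *\<^sub>R w k)"
    "sqdist (x + (1/2) *\<^sub>R w j + (1/2) *\<^sub>R w k) = sqdist (x + (1/2) *\<^sub>R w i)"
    by (rule sqdist_half_add; use ijk in auto)+
  then show ?thesis
    using False by (simp add: kummer_nth[OF ijk] sqdist_half_twice)
qed

lemma half_lattice_cases:
  assumes "u \<in> L"
  obtains (integral) "(1/2) *\<^sub>R u \<in> L" | (half) i where "(1/2) *\<^sub>R u - (1/2) *\<^sub>R w i \<in> L"
proof -
  have basis12: "lattice_basis (w 1) (w 2)"
    by (rule basis) simp
  obtain m n where u: "u = of_int m *\<^sub>R w 1 + of_int n *\<^sub>R w 2"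
    using basis12 assms by (rule lattice_basisE)
  define r where "r = of_int (m div 2) *\<^sub>R w 1 + of_int (n div 2) *\<^sub>R w 2"
  have r: "r \<in> L"
    unfolding r_def by (rule lattice_basis_combination_mem[OF basis12])
  have halve: "real_of_int t / 2 = of_int (t div 2) + of_int (t mod 2) / 2" for t
    using of_int_div_aux[of t 2] by simp
  have half_u: "(1/2) *\<^sub>R u = r + (1/2) *\<^sub>R (of_int (m mod 2) *\<^sub>R w 1 + of_int (n mod 2) *\<^sub>R w 2)"
    unfolding u r_def by (simp add: halve[of m] halve[of n] algebra_simps)
  have w3: "w 3 = - w 1 - w 2"
    by (rule superbase_third) simp
  have odd_odd: "(1/2) *\<^sub>R u - (1/2) *\<^sub>R w 3 \<in> L" if "m mod 2 = 1" "n mod 2 = 1"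
  proof -
    have "(1/2) *\<^sub>R u - (1/2) *\<^sub>R w 3 = r - w 3"
      unfolding half_u that w3 by (simp add: algebra_simps flip: scaleR_add_left)
    then show ?thesis
      using lattice_diff[OF r superbase_mem] by simp
  qed
  consider "m mod 2 = 0" "n mod 2 = 0" | "m mod 2 = 0" "n mod 2 = 1"
    | "m mod 2 = 1" "n mod 2 = 0" | "m mod 2 = 1" "n mod 2 = 1"
    by fastforce
  then show thesis
    using odd_odd by cases (use r half_u that(1) that(2)[of 1] that(2)[of 2] that(2)[of 3] in simp_all)
qed

lemma half_lattice_classes_reindex:
  fixes u :: "nat \<Rightarrow> 'a"
  assumes mem: "\<And>i. i < 4 \<Longrightarrow> u i \<in> L"
    and inequivalent: "\<And>i j. i < 4 \<Longrightarrow> j < 4 \<Longrightarrow> i \<noteq> j \<Longrightarrow> (1/2) *\<^sub>R (u i - u j) \<notin> L"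
  obtains \<sigma> :: "3 \<Rightarrow> 3" where "inj \<sigma>"
    "\<And>i. 0 < i \<Longrightarrow> i < 4 \<Longrightarrow> (1/2) *\<^sub>R (u i - u 0) - (1/2) *\<^sub>R w (\<sigma> (of_nat i)) \<in> L"
proof -
  have "\<exists>m. (1/2) *\<^sub>R (u i - u 0) - (1/2) *\<^sub>R w m \<in> L" if i: "0 < i" "i < 4" for i
    using half_lattice_cases[of "u i - u 0"] inequivalent[of i 0] lattice_diff[OF mem mem, of i 0] i
    by auto
  then obtain \<tau> where \<tau>:
    "\<And>i. 0 < i \<Longrightarrow> i < 4 \<Longrightarrow> (1/2) *\<^sub>R (u i - u 0) - (1/2) *\<^sub>R w (\<tau> i) \<in> L"
    by metis
  have distinct: "\<tau> i \<noteq> \<tau> j" if "0 < i" "i < 4" "0 < j" "j < 4" "i \<noteq> j" for i j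
  proof
    assume "\<tau> i = \<tau> j"
    then have "(1/2) *\<^sub>R (u i - u j) \<in> L"
      using lattice_diff[OF \<tau>[of i] \<tau>[of j]] that by (simp add: algebra_simps)
    then show False
      using inequivalent that by blast
  qed
  define \<sigma> :: "3 \<Rightarrow> 3" where "\<sigma> = ($) (vector [\<tau> 1, \<tau> 2, \<tau> 3])"
  have \<sigma>: "\<sigma> (of_nat i) = \<tau> i" if "0 < i" "i < 4" for i
  proof -
    have "i = 1 \<or> i = 2 \<or> i = 3"
      using that by linarith
    then show ?thesis
      by (auto simp: \<sigma>_def)
  qed
  have "inj \<sigma>"
    using distinct[of 1 2] distinct[of 1 3] distinct[of 2 3] by (simp add: inj_def \<sigma>_def forall_3)
  then show thesis
    by (rule that) (simp only: \<sigma> \<tau>)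
qed

lemma abs_kummer_half_shift:
  assumes "u \<in> L"
  shows "\<bar>kummer (x + (1/2) *\<^sub>R u) $ i\<bar> = \<bar>kummer x $ i\<bar>"
  using assms
proof (cases rule: half_lattice_cases)
  case integral
  then show ?thesis
    by (simp add: kummer_periodic)
next
  case (half j)
  have "kummer (x + (1/2) *\<^sub>R u) = kummer (x + (1/2) *\<^sub>R w j)"
    using kummer_periodic[OF half, of "x + (1/2) *\<^sub>R w j"] by simp
  then show ?thesis
    by (simp add: kummer_half_shift)
qed

end

section \<open>Tiles mapped onto the faces of a box\<close>

lemma linear_quadratic_le_int_translate:
  fixes p s y :: real and m :: int
  assumes "0 \<le> y" "y \<le> s" "p \<in> {- 1/2..0}"
  shows "y * p + s * p\<^sup>2 \<le> y * (p + of_int m) + s * (p + of_int m)\<^sup>2"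
proof -
  consider (zero) "m = 0" | (positive) "1 \<le> real_of_int m" | (negative) "real_of_int m \<le> - 1"
    by linarith
  then have "0 \<le> of_int m * (y + s * (of_int m + 2 * p))"
  proof cases
    case positive
    then have "0 \<le> s * (of_int m + 2 * p)"
      using assms by (intro mult_nonneg_nonneg) auto
    then show ?thesis
      using positive assms(1) by (intro mult_nonneg_nonneg) linarith+
  next
    case negative
    then have "s * (of_int m + 2 * p) \<le> s * (- 1)"
      using assms by (intro mult_left_mono) auto
    then show ?thesis
      using negative assms(2) by (intro mult_nonpos_nonpos) linarith+
  qed simp
  then show ?thesis
    by (simp add: power2_eq_square algebra_simps)
qed

lemma square_le_int_translate:
  fixes d :: real and k :: int
  assumes "\<bar>d\<bar> \<le> 1/2"
  shows "d\<^sup>2 \<le> (d + of_int k)\<^sup>2"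
proof (cases "k = 0")
  case False
  then have "1 \<le> \<bar>real_of_int k\<bar>"
    by linarith
  then have "\<bar>d\<bar> \<le> \<bar>d + of_int k\<bar>"
    using assms by linarith
  then show ?thesis
    by (simp add: abs_le_square_iff)
qed simp

context obtuse_superbase
begin

definition half_sides :: "real^3" where
  "half_sides = (\<chi> i. - Q (w (i + 1)) (w (i + 2)) / 2)"

lemma half_sides_nth:
  assumes "distinct [i, j, k]"
  shows "half_sides $ i = - Q (w j) (w k) / 2"
proof -
  have others: "UNIV - {i} = {j, k}" if "distinct [i, j, k]" for j k
    using that unfolding UNIV_distinct_3[OF that] by auto
  have "distinct [i, i + 1, i + 2]"
    using exhaust_3[of i] by auto
  then have "{j, k} = {i + 1, i + 2}"
    using others assms by metis
  then have "(j = i + 1 \<and> k = i + 2) \<or> (j = i + 2 \<and> k = i + 1)"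
    by (auto simp: doubleton_eq_iff)
  then show ?thesis
    by (auto simp: half_sides_def commute)
qed

lemma half_sides_pos: "0 < half_sides $ i"
  unfolding half_sides_def using obtuse[of "i + 1" "i + 2"] by simp

lemma superbase_norm:
  assumes "distinct [i, j, k]"
  shows "Q (w i) (w i) = 2 * half_sides $ j + 2 * half_sides $ k"
proof -
  have "half_sides $ j = - Q (w i) (w k) / 2" "half_sides $ k = - Q (w i) (w j) / 2"
    by (rule half_sides_nth; use assms in auto)+
  then show ?thesis
    unfolding superbase_third[OF assms] by (simp add: form_simps)
qed

definition tile :: "3 \<Rightarrow> 'a set" where
  "tile i = {x. \<forall>j. j \<noteq> i \<longrightarrow> 0 \<le> Q x (w j) \<and> 2 * Q x (w j) \<le> - Q (w i) (w j)}"

lemma mem_tile_iff: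
  assumes "distinct [i, j, k]"
  shows "x \<in> tile i \<longleftrightarrow>
    Q x (w j) \<in> {0..half_sides $ k} \<and> Q x (w k) \<in> {0..half_sides $ j}"
proof -
  have "half_sides $ j = - Q (w i) (w k) / 2" "half_sides $ k = - Q (w i) (w j) / 2"
    by (rule half_sides_nth; use assms in auto)+
  then show ?thesis
    using assms unfolding tile_def mem_Collect_eq forall_distinct_3[OF assms] by auto
qed

lemma selling_formula:
  assumes ijk: "distinct [i, j, k]"
  shows "Q (x + p *\<^sub>R w j + q *\<^sub>R w k) (x + p *\<^sub>R w j + q *\<^sub>R w k) =
    Q x x + 2 * ((Q x (w j) * p + half_sides $ k * p\<^sup>2)
      + (Q x (w k) * q + half_sides $ j * q\<^sup>2) + half_sides $ i * (p - q)\<^sup>2)"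
proof -
  have "Q (w j) (w j) = 2 * half_sides $ k + 2 * half_sides $ i"
    "Q (w k) (w k) = 2 * half_sides $ i + 2 * half_sides $ j"
    by (rule superbase_norm; use ijk in auto)+
  moreover have "Q (w j) (w k) = - 2 * half_sides $ i"
    using half_sides_nth[OF ijk] by simp
  ultimately show ?thesis
    by (simp add: form_simps commute[of "w j" x] commute[of "w k" x] commute[of "w k" "w j"]
        power2_eq_square algebra_simps)
qed

text \<open>In Selling's formula the quadratic part is a positive combination of \<open>p\<^sup>2\<close>, \<open>q\<^sup>2\<close> and
  \<open>(p - q)\<^sup>2\<close>, so that the three summands can be minimised separately.\<close>
lemma sqdist_on_tile:
  assumes ijk: "distinct [i, j, k]" and x: "x \<in> tile i"
    and pq: "p \<in> {- 1/2..0}" "q \<in> {- 1/2..0}"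
  shows "sqdist (x + p *\<^sub>R w j + q *\<^sub>R w k) =
    Q x x + 2 * ((Q x (w j) * p + half_sides $ k * p\<^sup>2)
      + (Q x (w k) * q + half_sides $ j * q\<^sup>2) + half_sides $ i * (p - q)\<^sup>2)"
proof -
  define f where "f p q = Q x x + 2 * ((Q x (w j) * p + half_sides $ k * p\<^sup>2)
      + (Q x (w k) * q + half_sides $ j * q\<^sup>2) + half_sides $ i * (p - q)\<^sup>2)" for p q
  note selling = selling_formula[OF ijk, of x, folded f_def]
  let ?z = "x + p *\<^sub>R w j + q *\<^sub>R w k"
  have in_tile: "0 \<le> Q x (w j)" "Q x (w j) \<le> half_sides $ k"
      "0 \<le> Q x (w k)" "Q x (w k) \<le> half_sides $ j"
    using x by (simp_all add: mem_tile_iff[OF ijk])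
  have translate: "f p q \<le> f (p + of_int m) (q + of_int n)" for m n
  proof -
    have "\<bar>p - q\<bar> \<le> 1/2"
      using pq unfolding atLeastAtMost_iff by linarith
    then have diff: "half_sides $ i * (p - q)\<^sup>2 \<le> half_sides $ i * (p - q + of_int (m - n))\<^sup>2"
      using half_sides_pos[of i] by (intro mult_left_mono square_le_int_translate) auto
    have "p - q + of_int (m - n) = (p + of_int m) - (q + of_int n)"
      by simp
    then show ?thesis
      using add_mono[OF add_mono[OF linear_quadratic_le_int_translate[OF in_tile(1,2) pq(1), of m]
            linear_quadratic_le_int_translate[OF in_tile(3,4) pq(2), of n]] diff]
      unfolding f_def by (simp only: add_le_cancel_left mult_le_cancel_left_pos zero_less_numeral)
  qed
  have "Q (?z + 0) (?z + 0) \<le> Q (?z + u) (?z + u)" if "u \<in> L" for u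
  proof -
    obtain m n where u: "u = of_int m *\<^sub>R w j + of_int n *\<^sub>R w k"
      using lattice_basisE[OF basis \<open>u \<in> L\<close>, of j k] ijk by auto
    have "?z + u = x + (p + of_int m) *\<^sub>R w j + (q + of_int n) *\<^sub>R w k"
      by (simp add: u algebra_simps)
    then show ?thesis
      using translate[of m n] by (simp only: add_0_right selling)
  qed
  then show ?thesis
    using sqdist_eqI[OF lattice_zero] by (simp add: selling f_def)
qed

lemma kummer_on_tile:
  assumes ijk: "distinct [i, j, k]" and x: "x \<in> tile i"
  shows "kummer x $ i = - half_sides $ i"
    "kummer x $ j = 2 * Q x (w k) - half_sides $ j"
    "kummer x $ k = 2 * Q x (w j) - half_sides $ k"
proof -
  note on_tile = sqdist_on_tile[OF ijk x]
  have reflect: "sqdist (x + (1/2) *\<^sub>R w m) = sqdist (x - (1/2) *\<^sub>R w m)" for m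
    by (rule sqdist_cong) (use superbase_mem in \<open>simp flip: scaleR_add_left\<close>)
  have sqdists:
    "sqdist x = Q x x"
    "sqdist (x + (1/2) *\<^sub>R w j) = Q x x - Q x (w j) + half_sides $ k / 2 + half_sides $ i / 2"
    "sqdist (x + (1/2) *\<^sub>R w k) = Q x x - Q x (w k) + half_sides $ j / 2 + half_sides $ i / 2"
    using on_tile[of 0 0] on_tile[of "- 1/2" 0] on_tile[of 0 "- 1/2"]
    by (simp_all add: reflect power2_eq_square)
  have "w i = - w j - w k"
    by (rule superbase_third) (use ijk in auto)
  then have half_i: "x + (1/2) *\<^sub>R w i = x - (1/2) *\<^sub>R w j - (1/2) *\<^sub>R w k"
    by (simp add: scaleR_diff_right)
  have sqdist_i: "sqdist (x + (1/2) *\<^sub>R w i) =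
      Q x x - Q x (w j) - Q x (w k) + half_sides $ j / 2 + half_sides $ k / 2"
    unfolding half_i using on_tile[of "- 1/2" "- 1/2"] by (simp add: power2_eq_square)
  have "distinct [j, i, k]" "distinct [k, i, j]"
    using ijk by auto
  then show "kummer x $ i = - half_sides $ i"
    "kummer x $ j = 2 * Q x (w k) - half_sides $ j"
    "kummer x $ k = 2 * Q x (w j) - half_sides $ k"
    using ijk by (simp_all add: kummer_nth sqdists sqdist_i del: distinct.simps)
qed

lemma combination_mem_tile:
  assumes ijk: "distinct [i, j, k]"
    and order: "0 \<le> t" "t \<le> s" "s \<le> 1"
    and gap: "half_sides $ i * (s - t) \<le> half_sides $ k * (1 - s)"
      "half_sides $ i * (s - t) \<le> half_sides $ j * t"
  shows "(1/2) *\<^sub>R (s *\<^sub>R w j + t *\<^sub>R w k) \<in> tile i"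
proof -
  let ?x = "(1/2) *\<^sub>R (s *\<^sub>R w j + t *\<^sub>R w k)"
  have "Q (w j) (w j) = 2 * half_sides $ k + 2 * half_sides $ i"
    "Q (w k) (w k) = 2 * half_sides $ i + 2 * half_sides $ j"
    by (rule superbase_norm; use ijk in auto)+
  moreover have "Q (w j) (w k) = - 2 * half_sides $ i"
    using half_sides_nth[OF ijk] by simp
  ultimately have
    "Q ?x (w j) = half_sides $ i * (s - t) + half_sides $ k * s"
    "Q ?x (w k) = half_sides $ j * t - half_sides $ i * (s - t)"
    by (simp_all add: form_simps commute[of "w k" "w j"] algebra_simps)
  moreover have "0 \<le> half_sides $ i * (s - t)" "0 \<le> half_sides $ k * s"
    "half_sides $ j * t \<le> half_sides $ j"
    using order half_sides_pos[of i] half_sides_pos[of j] half_sides_pos[of k]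
    by (simp_all add: mult_le_cancel_left1)
  ultimately show ?thesis
    using gap by (simp add: mem_tile_iff[OF ijk] right_diff_distrib)
qed

text \<open>The points \<open>0 \<le> t \<le> s \<le> 1\<close> divide the circle of length 1 into gaps \<open>t\<close>, \<open>s - t\<close> and \<open>1 - s\<close>.
  After weighting the gaps by half-sides, the smallest one selects the tile.\<close>
lemma tiles_cover_triangle:
  assumes ijk: "distinct [i, j, k]" and order: "0 \<le> t" "t \<le> s" "s \<le> 1"
  shows "\<exists>u\<in>L. \<exists>m. (1/2) *\<^sub>R (s *\<^sub>R w j + t *\<^sub>R w k) + (1/2) *\<^sub>R u \<in> tile m"
proof -
  have sum: "w k = - w i - w j"
    by (rule superbase_third[OF ijk])
  let ?gap_i = "half_sides $ i * (s - t)" and ?gap_k = "half_sides $ k * (1 - s)"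
    and ?gap_j = "half_sides $ j * t"
  consider (i_smallest) "?gap_i \<le> ?gap_k" "?gap_i \<le> ?gap_j"
    | (k_smallest) "?gap_k \<le> ?gap_i" "?gap_k \<le> ?gap_j"
    | (j_smallest) "?gap_j \<le> ?gap_i" "?gap_j \<le> ?gap_k"
    by linarith
  then show ?thesis
  proof cases
    case i_smallest
    then have "(1/2) *\<^sub>R (s *\<^sub>R w j + t *\<^sub>R w k) \<in> tile i"
      using ijk order by (intro combination_mem_tile)
    then show ?thesis
      by (intro bexI[of _ 0] exI[of _ i] lattice_zero) simp
  next
    case k_smallest
    then have "(1/2) *\<^sub>R ((1 - t) *\<^sub>R w i + (s - t) *\<^sub>R w j) \<in> tile k"
      using ijk order by (intro combination_mem_tile) auto
    also have "(1 - t) *\<^sub>R w i + (s - t) *\<^sub>R w j = s *\<^sub>R w j + t *\<^sub>R w k + w i"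
      by (simp add: sum algebra_simps)
    finally show ?thesis
      unfolding scaleR_add_right using superbase_mem by blast
  next
    case j_smallest
    then have "(1/2) *\<^sub>R ((1 - s + t) *\<^sub>R w k + (1 - s) *\<^sub>R w i) \<in> tile j"
      using ijk order by (intro combination_mem_tile) auto
    also have "(1 - s + t) *\<^sub>R w k + (1 - s) *\<^sub>R w i = s *\<^sub>R w j + t *\<^sub>R w k + - w j"
      by (simp add: sum algebra_simps)
    finally show ?thesis
      unfolding scaleR_add_right using superbase_mem lattice_uminus by blast
  qed
qed

lemma tiles_cover:
  obtains u i where "u \<in> L" "x + (1/2) *\<^sub>R u \<in> tile i"
proof -
  have basis12: "lattice_basis (w 1) (w 2)"
    by (rule basis) simp
  obtain a c where coordinates: "2 *\<^sub>R x = a *\<^sub>R w 1 + c *\<^sub>R w 2"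
    using lattice_basis_coordinates[OF basis12] by blast
  define v where "v = of_int \<lfloor>a\<rfloor> *\<^sub>R w 1 + of_int \<lfloor>c\<rfloor> *\<^sub>R w 2"
  have "v \<in> L"
    unfolding v_def by (rule lattice_basis_combination_mem[OF basis12])
  have unit: "0 \<le> frac a" "frac a \<le> 1" "0 \<le> frac c" "frac c \<le> 1"
    by (simp_all add: less_imp_le[OF frac_lt_1])
  have "\<exists>u\<in>L. \<exists>i. (1/2) *\<^sub>R (frac a *\<^sub>R w 1 + frac c *\<^sub>R w 2) + (1/2) *\<^sub>R u \<in> tile i"
  proof (cases "frac c \<le> frac a")
    case True
    then show ?thesis
      using tiles_cover_triangle[of 3 1 2 "frac c" "frac a"] unit by auto
  next
    case False
    then show ?thesis
      using tiles_cover_triangle[of 3 2 1 "frac a" "frac c"] unit by (auto simp: add.commute)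
  qed
  then obtain u i where u: "u \<in> L"
    "(1/2) *\<^sub>R (frac a *\<^sub>R w 1 + frac c *\<^sub>R w 2) + (1/2) *\<^sub>R u \<in> tile i"
    by blast
  have "frac a *\<^sub>R w 1 + frac c *\<^sub>R w 2 = 2 *\<^sub>R x - v"
    unfolding coordinates v_def frac_def by (simp add: algebra_simps)
  then have "(1/2) *\<^sub>R (frac a *\<^sub>R w 1 + frac c *\<^sub>R w 2) + (1/2) *\<^sub>R u = x + (1/2) *\<^sub>R (u - v)"
    by (simp add: scaleR_diff_right)
  then have "x + (1/2) *\<^sub>R (u - v) \<in> tile i"
    using u(2) by (simp only:)
  then show thesis
    using that lattice_diff[OF u(1) \<open>v \<in> L\<close>] by blast
qed

lemma kummer_mem_box_frontier: "kummer x \<in> frontier (cbox (- half_sides) half_sides)"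
proof -
  obtain u i where u: "u \<in> L" and in_tile: "x + (1/2) *\<^sub>R u \<in> tile i"
    using tiles_cover by blast
  let ?y = "x + (1/2) *\<^sub>R u"
  obtain j k where ijk: "distinct [i, j, k]"
    by (rule ex_other_indices)
  have "\<bar>kummer ?y $ i\<bar> = half_sides $ i" "\<bar>kummer ?y $ j\<bar> \<le> half_sides $ j"
    "\<bar>kummer ?y $ k\<bar> \<le> half_sides $ k"
    using in_tile half_sides_pos[of i] unfolding kummer_on_tile[OF ijk in_tile]
    by (auto simp: mem_tile_iff[OF ijk] abs_le_iff)
  then have "(\<forall>m. \<bar>kummer ?y $ m\<bar> \<le> half_sides $ m) \<and> (\<exists>m. \<bar>kummer ?y $ m\<bar> = half_sides $ m)"
    unfolding forall_distinct_3[OF ijk] by auto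
  then show ?thesis
    by (simp add: frontier_symmetric_box abs_kummer_half_shift[OF u])
qed

lemma kummer_onto_lower_face:
  assumes "y $ i = - half_sides $ i" "\<And>m. \<bar>y $ m\<bar> \<le> half_sides $ m"
  shows "y \<in> range kummer"
proof -
  obtain j k where ijk: "distinct [i, j, k]"
    by (rule ex_other_indices)
  then have "lattice_basis (w j) (w k)"
    by (intro basis) simp
  then obtain x where x: "Q x (w j) = (y $ k + half_sides $ k) / 2"
      "Q x (w k) = (y $ j + half_sides $ j) / 2"
    using prescribed_pairings_exist by blast
  then have "x \<in> tile i"
    using assms(2)[of j] assms(2)[of k] by (simp add: mem_tile_iff[OF ijk] abs_le_iff)
  then have "kummer x $ i = y $ i \<and> kummer x $ j = y $ j \<and> kummer x $ k = y $ k"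
    using assms(1) by (simp add: kummer_on_tile[OF ijk] x field_simps)
  then have "kummer x = y"
    unfolding vec_eq_iff forall_distinct_3[OF ijk] .
  then show ?thesis
    by blast
qed

lemma range_kummer: "range kummer = frontier (cbox (- half_sides) half_sides)"
proof (intro equalityI subsetI)
  fix y assume "y \<in> frontier (cbox (- half_sides) half_sides)"
  then obtain i where bound: "\<And>m. \<bar>y $ m\<bar> \<le> half_sides $ m" and face: "\<bar>y $ i\<bar> = half_sides $ i"
    by (auto simp: frontier_symmetric_box)
  show "y \<in> range kummer"
  proof (cases "y $ i = - half_sides $ i")
    case True
    then show ?thesis
      using bound by (rule kummer_onto_lower_face)
  next
    case False
    define y' where "y' = (\<chi> m. (if m = i + 1 then 1 else - 1) * y $ m)"
    have "y' \<in> range kummer"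
    proof (rule kummer_onto_lower_face)
      show "y' $ i = - half_sides $ i" "\<bar>y' $ m\<bar> \<le> half_sides $ m" for m
        using False face bound[of m] by (auto simp: y'_def)
    qed
    then obtain x where "y' = kummer x"
      by blast
    then have "y $ m = kummer (x + (1/2) *\<^sub>R w (i + 1)) $ m" for m
      unfolding kummer_half_shift by (simp add: y'_def flip: \<open>y' = kummer x\<close>)
    then have "y = kummer (x + (1/2) *\<^sub>R w (i + 1))"
      by (simp add: vec_eq_iff)
    then show ?thesis
      by blast
  qed
qed (use kummer_mem_box_frontier in blast)

lemma abs_kummer_half_lattice:
  assumes "u \<in> L"
  shows "\<bar>kummer ((1/2) *\<^sub>R u) $ i\<bar> = half_sides $ i"
proof -
  obtain j k where ijk: "distinct [i, j, k]"
    by (rule ex_other_indices)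
  have "0 \<in> tile i"
    using half_sides_pos[of j] half_sides_pos[of k] by (simp add: mem_tile_iff[OF ijk] form_simps)
  then show ?thesis
    using abs_kummer_half_shift[OF assms, of 0 i] kummer_on_tile(1)[OF ijk] half_sides_pos[of i]
    by simp
qed

lemma kummer_parallelepiped:
  obtains p v1 v2 v3 where "v1 \<noteq> v2" "v1 \<noteq> v3" "v2 \<noteq> v3" "independent {v1, v2, v3}"
    "frontier (parallelepiped p v1 v2 v3) = inverse_hadamard ` range kummer"
    "parallelepiped_vertices p v1 v2 v3 = inverse_hadamard ` {y. \<forall>i. \<bar>y $ i\<bar> = half_sides $ i}"
proof -
  have "(- half_sides) $ i < half_sides $ i" for i
    using half_sides_pos[of i] by simp
  then obtain p v1 v2 v3 where edges: "v1 \<noteq> v2" "v1 \<noteq> v3" "v2 \<noteq> v3" "independent {v1, v2, v3}"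
    and solid: "inverse_hadamard ` cbox (- half_sides) half_sides = parallelepiped p v1 v2 v3"
    and vertices: "inverse_hadamard ` {y. \<forall>i. y $ i \<in> {(- half_sides) $ i, half_sides $ i}} =
      parallelepiped_vertices p v1 v2 v3"
    by (rule linear_image_box_parallelepiped[OF linear_inverse_hadamard inj_inverse_hadamard])
  have "frontier (parallelepiped p v1 v2 v3) = inverse_hadamard ` range kummer"
    unfolding range_kummer solid[symmetric]
    by (rule frontier_injective_linear_image[OF linear_inverse_hadamard inj_inverse_hadamard])
  moreover have "t \<in> {(- half_sides) $ i, half_sides $ i} \<longleftrightarrow> \<bar>t\<bar> = half_sides $ i" for t i
    using half_sides_pos[of i] by auto
  ultimately show thesis
    using that edges vertices by simp
qed

end

section \<open>Principally polarized surfaces\<close>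

locale principally_polarized_plane =
  fixes Q :: "real^2 \<Rightarrow> real^2 \<Rightarrow> real" and L :: "(real^2) set"
  assumes principal: "principal_polarization Q L"

sublocale principally_polarized_plane \<subseteq> lattice_plane Q L
proof unfold_locales
  obtain u v where uv: "u \<noteq> v" "independent {u, v}" "L = {of_int a *\<^sub>R u + of_int c *\<^sub>R v | a c. True}"
    using principal unfolding principal_polarization_def full_lattice_def by blast
  then have "span {u, v} = UNIV"
    using card_ge_dim_independent[of "{u, v}" UNIV] by auto
  with uv show "\<exists>u v. u \<noteq> v \<and> independent {u, v} \<and> span {u, v} = UNIV \<and>
      L = {of_int a *\<^sub>R u + of_int c *\<^sub>R v | a c. True}"
    by blast
qed (use principal in \<open>simp_all add: principal_polarization_def\<close>)

context principally_polarized_plane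
begin

lemma lam_bij_betw: "bij_betw (lam Q) L intpts"
  using principal by (simp add: principal_polarization_def)

lemma linear_lam: "linear (lam Q)"
  by (rule linearI) (auto simp: lam_def vec_eq_iff form_simps)

lemma lam_inner: "lam Q u \<bullet> x = Q u x"
proof -
  have "x = (x $ 1) *\<^sub>R axis 1 1 + (x $ 2) *\<^sub>R axis 2 1"
    by (simp add: vec_eq_iff forall_2 axis_def)
  then have "Q u x = Q u ((x $ 1) *\<^sub>R axis 1 1 + (x $ 2) *\<^sub>R axis 2 1)"
    by simp
  also have "\<dots> = lam Q u \<bullet> x"
    by (simp add: form_simps lam_def inner_vec_def sum_2)
  finally show ?thesis
    by simp
qed

lemma inj_lam: "inj (lam Q)"
proof -
  have "u = 0" if "lam Q u = 0" for u
    using lam_inner[of u u] positive[of u] that by auto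
  then show ?thesis
    unfolding linear_injective_0[OF linear_lam] by blast
qed

text \<open>The polarization being principal, that is, surjectivity of \<open>\<lambda> : M' \<rightarrow> M\<close>, gives the converse
  direction.\<close>
lemma mem_intpts_iff_pairing_integral: "x \<in> intpts \<longleftrightarrow> (\<forall>u\<in>L. Q u x \<in> \<int>)"
proof
  assume "x \<in> intpts"
  then show "\<forall>u\<in>L. Q u x \<in> \<int>"
    using principal by (auto simp: principal_polarization_def)
next
  assume integral: "\<forall>u\<in>L. Q u x \<in> \<int>"
  have "x $ i \<in> \<int>" for i
  proof -
    have "axis i 1 \<in> intpts"
      by (simp add: intpts_def axis_def)
    then obtain u where "u \<in> L" "lam Q u = axis i 1"
      using lam_bij_betw unfolding bij_betw_def by (metis imageE)
    then show ?thesis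
      using integral lam_inner[of u x] by (simp add: inner_axis')
  qed
  then show "x \<in> intpts"
    by (simp add: intpts_def)
qed

lemma mem_intpts_iff_basis_pairing_integral:
  assumes "lattice_basis u v"
  shows "x \<in> intpts \<longleftrightarrow> Q u x \<in> \<int> \<and> Q v x \<in> \<int>"
proof
  assume integral: "Q u x \<in> \<int> \<and> Q v x \<in> \<int>"
  have "Q y x \<in> \<int>" if y: "y \<in> L" for y
  proof -
    obtain a c where "y = of_int a *\<^sub>R u + of_int c *\<^sub>R v"
      using assms y by (rule lattice_basisE)
    then show ?thesis
      using integral by (simp add: form_simps)
  qed
  then show "x \<in> intpts"
    by (simp add: mem_intpts_iff_pairing_integral)
qed (use lattice_basis_mem[OF assms] mem_intpts_iff_pairing_integral in blast)

definition pairings :: "real^2 \<Rightarrow> real^2 \<Rightarrow> real^2 \<Rightarrow> real^2" where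
  "pairings u v x = vector [Q u x, Q v x]"

lemma pairings_nth [simp]: "pairings u v x $ 1 = Q u x" "pairings u v x $ 2 = Q v x"
  by (simp_all add: pairings_def)

lemma linear_pairings: "linear (pairings u v)"
  by (rule linearI) (auto simp: vec_eq_iff forall_2 form_simps)

lemma bij_pairings:
  assumes "lattice_basis u v"
  shows "bij (pairings u v)"
proof -
  have "\<exists>x. y = pairings u v x" for y
  proof -
    obtain x where "Q x u = y $ 1" "Q x v = y $ 2"
      using assms by (rule prescribed_pairings_exist)
    then have "y = pairings u v x"
      by (simp add: vec_eq_iff forall_2 commute)
    then show ?thesis ..
  qed
  then have "surj (pairings u v)"
    by (simp add: surj_def)
  then show ?thesis
    using linear_surjective_imp_injective[OF linear_pairings] by (simp add: bij_def)
qed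

lemma pairings_image_intpts:
  assumes "lattice_basis u v"
  shows "pairings u v ` intpts = intpts"
proof -
  have "pairings u v x \<in> intpts \<longleftrightarrow> x \<in> intpts" for x
    unfolding mem_intpts_iff_basis_pairing_integral[OF assms, of x]
    by (simp add: intpts_def forall_2)
  then have "intpts = pairings u v -` intpts"
    by blast
  then show ?thesis
    using bij_pairings[OF assms] by (metis bij_is_surj surj_image_vimage_eq)
qed

lemma orthogonal_basis_reducible:
  assumes uv: "lattice_basis u v" and orthogonal: "Q u v = 0"
  shows "reducible_pav Q L"
proof -
  let ?\<phi> = "pairings u v"
  have orthogonal': "Q v u = 0"
    using orthogonal by (simp add: commute)
  have norms: "0 < Q u u" "0 < Q v v"
    using lattice_basis_gram_positive[OF uv] orthogonal nonneg[of u] nonneg[of v]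
    by (auto simp: zero_less_mult_iff)
  have "?\<phi> (of_int a *\<^sub>R u + of_int c *\<^sub>R v) = vector [of_int a * Q u u, of_int c * Q v v]" for a c
    by (simp add: pairings_def form_simps orthogonal orthogonal')
  then have lattice: "?\<phi> ` L = {vector [of_int a * Q u u, of_int c * Q v v] | a c. True}"
    using uv unfolding lattice_basis_def by (force simp: image_iff)
  have form: "Q x y = (1 / Q u u) * (?\<phi> x $ 1) * (?\<phi> y $ 1) + (1 / Q v v) * (?\<phi> x $ 2) * (?\<phi> y $ 2)"
    for x y
  proof -
    have "Q x y = Q ((Q u x / Q u u) *\<^sub>R u + (Q v x / Q v v) *\<^sub>R v) y"
      using orthogonal_basis_expansion[OF uv orthogonal, of x] by simp
    then show ?thesis
      by (simp add: form_simps)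
  qed
  show ?thesis
    unfolding reducible_pav_def
    by (intro exI[of _ ?\<phi>] exI[of _ "Q u u"] exI[of _ "Q v v"] exI[of _ "1 / Q u u"]
        exI[of _ "1 / Q v v"] conjI allI linear_pairings bij_pairings[OF uv]
        pairings_image_intpts[OF uv] lattice form)
      (use norms in simp_all)
qed

lemma theta_eq_sqdist:
  assumes "2 *\<^sub>R lam Q c = d"
  shows "theta Q L d x = sqdist (x + c) - Q x x"
proof -
  have "inj (\<lambda>v. 2 *\<^sub>R lam Q v)"
    using inj_lam by (simp add: inj_def)
  then have inv: "inv (\<lambda>v. 2 *\<^sub>R lam Q v) d = c"
    using inv_f_f assms by fastforce
  have "2 * Q x (u + c) + Q (u + c) (u + c) = - Q x x + Q (x + c + u) (x + c + u)" for u
    using form_add_self[of x "u + c"] by (simp add: ac_simps)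
  then have "theta Q L d x = (INF u\<in>L. - Q x x + Q (x + c + u) (x + c + u))"
    by (simp add: theta_def inv)
  also have "\<dots> = - Q x x + sqdist (x + c)"
    unfolding sqdist_def
    using nonneg lattice_zero by (intro Inf_add_eq bdd_belowI2[where m = 0]) auto
  finally show ?thesis
    by simp
qed

lemma theta_reps_half_lattice:
  assumes "theta_reps Q L b"
  obtains u where "\<And>i. i < 4 \<Longrightarrow> u i \<in> L"
    "\<And>i j. i < 4 \<Longrightarrow> j < 4 \<Longrightarrow> i \<noteq> j \<Longrightarrow> (1/2) *\<^sub>R (u i - u j) \<notin> L"
    "\<And>i x. i < 4 \<Longrightarrow> theta Q L (b i) x = sqdist (x + (1/2) *\<^sub>R u i) - Q x x"
proof -
  have "\<exists>u\<in>L. lam Q u = b i" if "i < 4" for i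
    using assms that lam_bij_betw unfolding theta_reps_def bij_betw_def by (metis imageE)
  then obtain u where u: "\<And>i. i < 4 \<Longrightarrow> u i \<in> L" "\<And>i. i < 4 \<Longrightarrow> lam Q (u i) = b i"
    by metis
  have lam_half: "2 *\<^sub>R lam Q ((1/2) *\<^sub>R x) = lam Q x" for x
    by (simp add: linear_cmul[OF linear_lam])
  show thesis
  proof (rule that[OF u(1)])
    fix i j :: nat
    assume ij: "i < 4" "j < 4" "i \<noteq> j"
    have "2 *\<^sub>R lam Q ((1/2) *\<^sub>R (u i - u j)) = b i - b j"
      unfolding lam_half using ij u(2) by (simp add: linear_diff[OF linear_lam])
    then show "(1/2) *\<^sub>R (u i - u j) \<notin> L"
      using assms ij unfolding theta_reps_def by (metis image_eqI)
  next
    show "theta Q L (b i) x = sqdist (x + (1/2) *\<^sub>R u i) - Q x x" if "i < 4" for i x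
      using that u(2) lam_half by (intro theta_eq_sqdist) simp
  qed
qed

lemma theta_reps_superbase:
  assumes irreducible: "irreducible_pav Q L" and reps: "theta_reps Q L b"
  obtains w u where "obtuse_superbase Q L w" "u \<in> L"
    "\<And>i x. i < 4 \<Longrightarrow> theta Q L (b i) x =
      obtuse_superbase.half_sqdists Q L w (x + (1/2) *\<^sub>R u) i - Q x x"
proof -
  obtain v where "obtuse_superbase Q L v"
    using obtuse_superbase_exists orthogonal_basis_reducible irreducible
    unfolding irreducible_pav_def by blast
  then interpret v: obtuse_superbase Q L v .
  obtain u where u: "\<And>i. i < 4 \<Longrightarrow> u i \<in> L"
    and inequivalent: "\<And>i j. i < 4 \<Longrightarrow> j < 4 \<Longrightarrow> i \<noteq> j \<Longrightarrow> (1/2) *\<^sub>R (u i - u j) \<notin> L"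
    and theta: "\<And>i x. i < 4 \<Longrightarrow> theta Q L (b i) x = sqdist (x + (1/2) *\<^sub>R u i) - Q x x"
    using theta_reps_half_lattice[OF reps] by blast
  obtain \<sigma> :: "3 \<Rightarrow> 3" where "inj \<sigma>" and
    \<sigma>: "\<And>i. 0 < i \<Longrightarrow> i < 4 \<Longrightarrow> (1/2) *\<^sub>R (u i - u 0) - (1/2) *\<^sub>R v (\<sigma> (of_nat i)) \<in> L"
    using v.half_lattice_classes_reindex[of u] u inequivalent by blast
  from \<open>inj \<sigma>\<close> have superbase: "obtuse_superbase Q L (v \<circ> \<sigma>)"
    by (rule v.superbase_reindex)
  have "sqdist (x + (1/2) *\<^sub>R u i) =
    obtuse_superbase.half_sqdists Q L (v \<circ> \<sigma>) (x + (1/2) *\<^sub>R u 0) i" if "i < 4" for i x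
    unfolding obtuse_superbase.half_sqdists_def[OF superbase]
    using \<sigma>[of i] that by (auto intro!: sqdist_cong simp: scaleR_diff_right algebra_simps)
  then show thesis
    using that[OF superbase u[of 0]] theta by simp
qed

end

theorem theorem4p7:
  fixes Q :: "real^2 \<Rightarrow> real^2 \<Rightarrow> real" and L :: "(real^2) set"
    and b :: "nat \<Rightarrow> real^2"
  assumes "principal_polarization Q L"
    and "irreducible_pav Q L"
    and "theta_reps Q L b"
  shows "\<exists>p v1 v2 v3. v1 \<noteq> v2 \<and> v1 \<noteq> v3 \<and> v2 \<noteq> v3 \<and> independent {v1, v2, v3} \<and>
           (\<lambda>x. torus_pt (\<lambda>i. theta Q L (b i) x)) ` UNIV = frontier (parallelepiped p v1 v2 v3) \<and>
           parallelepiped_vertices p v1 v2 v3 =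
             {torus_pt (g (\<lambda>i. theta Q L (b i) 0)) | g. g \<in> klein_iota}"
proof -
  interpret principally_polarized_plane Q L
    by unfold_locales fact
  obtain w u where "obtuse_superbase Q L w" and u: "u \<in> L"
    and theta: "\<And>i x. i < 4 \<Longrightarrow> theta Q L (b i) x =
      obtuse_superbase.half_sqdists Q L w (x + (1/2) *\<^sub>R u) i - Q x x"
    using theta_reps_superbase assms(2,3) by blast
  then interpret obtuse_superbase Q L w
    by simp
  have hadamard: "hadamard (\<lambda>i. theta Q L (b i) x) = kummer (x + (1/2) *\<^sub>R u)" for x
    by (simp add: hadamard_def kummer_def theta vec_eq_iff forall_3)
  have "range (\<lambda>x. torus_pt (\<lambda>i. theta Q L (b i) x)) =
      inverse_hadamard ` kummer ` range (\<lambda>x. x + (1/2) *\<^sub>R u)"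
    by (simp only: torus_pt_eq_inverse_hadamard hadamard image_image)
  then have image: "range (\<lambda>x. torus_pt (\<lambda>i. theta Q L (b i) x)) = inverse_hadamard ` range kummer"
    by (simp only: surj_plus_right)
  have vertices: "{torus_pt (g (\<lambda>i. theta Q L (b i) 0)) | g. g \<in> klein_iota} =
      inverse_hadamard ` {y. \<forall>i. \<bar>y $ i\<bar> = half_sides $ i}"
    by (simp only: torus_pt_klein_iota_orbit hadamard add_0 abs_kummer_half_lattice[OF u])
  show ?thesis
    unfolding image vertices by (rule kummer_parallelepiped) metis
qed

end
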